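(* Let $n\ge 4$, let $|\psi\rangle\in\bigotimes_{i=1}^n \mathcal H_{d_i}$ be a pure quantum state, and let $R^{(i)}:U(1)\to GL(\mathbb C^{d_i})$, $i=1,\dots,n$, be continuous representations such that $|\psi\rangle$ is $U(1)$-invariant with respect to the representations $R^{(i)}$. Then for every party $k\in\{1,\dots,n\}$ on which the adjoint action is nontrivial, i.e. for which the maps $X\mapsto R^{(k)}(g)XR^{(k)}(g)^\dagger$ on $d_k\times d_k$ matrices are not all equal to the identity map ($g\in U(1)$), there is a party $l\neq k$ such that the two-party marginal satisfies $\rho_{\{k,l\}}\neq \frac{\mathbb 1}{d_k}\otimes\rho_l$. In particular, $\rho_{\{k,l\}}$ is not the maximally mixed two-party state.
   Context: $\mathcal H_d=\mathbb C^d$ is the $d$-dimensional Hilbert space. A state $|\psi\rangle$ (a unit vector) is called $G$-invariant with respect to representations $R^{(i)}:G\to GL(\mathbb C^{d_i})$ if, with $R(g)=\bigotimes_{i=1}^n R^{(i)}(g)$, one has $R(g)|\psi\rangle\langle\psi|R(g)^\dagger=|\psi\rangle\langle\psi|$ for all $g\in G$. For a set of parties $\mathcal A\subseteq\{1,\dots,n\}$ the marginal is $\rho_{\mathcal A}=\operatorname{tr}_{\mathcal A^c}|\psi\rangle\langle\psi|$, and $\rho_l=\rho_{\{l\}}$. It is maximally mixed if it is proportional to the identity. *)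

theory Defs
  imports Complex_Main "HOL-Library.FuncSet" "HOL-Algebra.Group"
    "Jordan_Normal_Form.Matrix" "Jordan_Normal_Form.Schur_Decomposition"
begin

section \<open>Tensor products of finite-dimensional Hilbert spaces\<close>

text \<open>
  Parties are natural numbers and party \<open>i\<close> has local dimension \<open>d i\<close>. For a finite set \<open>A\<close> of
  parties, the product basis of \<open>\<Otimes>i\<in>A. \<complex>^(d i)\<close> is labelled by the multi-indices below. A vector is
  given by its coordinates and an operator by its matrix entries in this basis; only their values
  on multi-indices carry meaning. Multi-indices are extensional functions, so that distinct
  multi-indices differ at some party in \<open>A\<close>.
\<close>

type_synonym tensor_vec = "(nat \<Rightarrow> nat) \<Rightarrow> complex"
type_synonym tensor_op = "(nat \<Rightarrow> nat) \<Rightarrow> (nat \<Rightarrow> nat) \<Rightarrow> complex"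

definition multi_index :: "(nat \<Rightarrow> nat) \<Rightarrow> nat set \<Rightarrow> (nat \<Rightarrow> nat) set" where
  "multi_index d A = (\<Pi>\<^sub>E i\<in>A. {0..<d i})"

definition op_eq :: "(nat \<Rightarrow> nat) \<Rightarrow> nat set \<Rightarrow> tensor_op \<Rightarrow> tensor_op \<Rightarrow> bool" where
  "op_eq d A S T \<longleftrightarrow> (\<forall>a\<in>multi_index d A. \<forall>b\<in>multi_index d A. S a b = T a b)"

definition op_mult :: "(nat \<Rightarrow> nat) \<Rightarrow> nat set \<Rightarrow> tensor_op \<Rightarrow> tensor_op \<Rightarrow> tensor_op" where
  "op_mult d A S T = (\<lambda>a b. \<Sum>c\<in>multi_index d A. S a c * T c b)"

definition op_adjoint :: "tensor_op \<Rightarrow> tensor_op" where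
  "op_adjoint S = (\<lambda>a b. cnj (S b a))"

definition op_id :: tensor_op where
  "op_id = (\<lambda>a b. if a = b then 1 else 0)"

definition op_scale :: "complex \<Rightarrow> tensor_op \<Rightarrow> tensor_op" where
  "op_scale c S = (\<lambda>a b. c * S a b)"

text \<open>Tensor product of an operator on the parties \<open>A\<close> and one on the parties \<open>B\<close>, for disjoint
  \<open>A\<close> and \<open>B\<close>; the result acts on the parties \<open>A \<union> B\<close>.\<close>

definition op_tensor :: "nat set \<Rightarrow> nat set \<Rightarrow> tensor_op \<Rightarrow> tensor_op \<Rightarrow> tensor_op" where
  "op_tensor A B S T =
     (\<lambda>a b. S (restrict a A) (restrict b A) * T (restrict a B) (restrict b B))"

definition local_tensor :: "nat set \<Rightarrow> (nat \<Rightarrow> complex mat) \<Rightarrow> tensor_op" where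
  "local_tensor A M = (\<lambda>a b. \<Prod>i\<in>A. M i $$ (a i, b i))"

text \<open>Partial trace over the parties \<open>B\<close>, leaving an operator on the parties \<open>A\<close>, for disjoint
  \<open>A\<close> and \<open>B\<close>: \<open>override_on c a A\<close> is the multi-index on \<open>A \<union> B\<close> that combines \<open>a\<close> and \<open>c\<close>.\<close>

definition partial_trace ::
    "(nat \<Rightarrow> nat) \<Rightarrow> nat set \<Rightarrow> nat set \<Rightarrow> tensor_op \<Rightarrow> tensor_op" where
  "partial_trace d A B S =
     (\<lambda>a b. \<Sum>c\<in>multi_index d B. S (override_on c a A) (override_on c b A))"


section \<open>Pure states and their marginals\<close>

text \<open>A unit vector exists only if all \<open>d i\<close> with \<open>i \<in> P\<close> are positive.\<close>

definition pure_state :: "(nat \<Rightarrow> nat) \<Rightarrow> nat set \<Rightarrow> tensor_vec \<Rightarrow> bool" where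
  "pure_state d P \<psi> \<longleftrightarrow> (\<Sum>a\<in>multi_index d P. (cmod (\<psi> a))\<^sup>2) = 1"

definition projector :: "tensor_vec \<Rightarrow> tensor_op" where
  "projector \<psi> = (\<lambda>a b. \<psi> a * cnj (\<psi> b))"

definition marginal :: "(nat \<Rightarrow> nat) \<Rightarrow> nat set \<Rightarrow> tensor_vec \<Rightarrow> nat set \<Rightarrow> tensor_op" where
  "marginal d P \<psi> A = partial_trace d A (P - A) (projector \<psi>)"

definition maximally_mixed :: "(nat \<Rightarrow> nat) \<Rightarrow> nat set \<Rightarrow> tensor_op \<Rightarrow> bool" where
  "maximally_mixed d A \<rho> \<longleftrightarrow> (\<exists>c. op_eq d A \<rho> (op_scale c op_id))"


section \<open>Representations and invariance\<close>

definition U1 :: "complex monoid" where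
  "U1 = \<lparr>carrier = {z. cmod z = 1}, monoid.mult = (*), one = 1\<rparr>"

definition GL :: "nat \<Rightarrow> complex mat monoid" where
  "GL m = units_of (ring_mat TYPE(complex) m ())"

definition continuous_rep ::
    "('g::topological_space) monoid \<Rightarrow> nat \<Rightarrow> ('g \<Rightarrow> complex mat) \<Rightarrow> bool" where
  "continuous_rep G m \<pi> \<longleftrightarrow>
     \<pi> \<in> hom G (GL m) \<and>
     (\<forall>a<m. \<forall>b<m. continuous_on (carrier G) (\<lambda>g. \<pi> g $$ (a, b)))"

definition invariant_state ::
    "'g monoid \<Rightarrow> (nat \<Rightarrow> nat) \<Rightarrow> nat set \<Rightarrow> (nat \<Rightarrow> 'g \<Rightarrow> complex mat) \<Rightarrow> tensor_vec \<Rightarrow> bool" where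
  "invariant_state G d P R \<psi> \<longleftrightarrow>
     (\<forall>g\<in>carrier G.
        let Rg = local_tensor P (\<lambda>i. R i g)
        in op_eq d P
             (op_mult d P (op_mult d P Rg (projector \<psi>)) (op_adjoint Rg))
             (projector \<psi>))"

definition nontrivial_adjoint_action ::
    "'g monoid \<Rightarrow> nat \<Rightarrow> ('g \<Rightarrow> complex mat) \<Rightarrow> bool" where
  "nontrivial_adjoint_action G m \<pi> \<longleftrightarrow>
     \<not> (\<forall>g\<in>carrier G. \<forall>X\<in>carrier_mat m m. \<pi> g * X * mat_adjoint (\<pi> g) = X)"

end

theory Submission
  imports Defs "HOL-Analysis.Interval_Integral"
begin

text \<open>
  The restriction of each \<open>R i\<close> to \<open>t \<mapsto> cis t\<close> has a generator \<open>H i\<close>, and differentiating the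
  invariance of the projector at \<open>t = 0\<close> shows that \<open>\<psi>\<close> is an eigenvector of \<open>\<Sum>i. H i\<close>, where
  \<open>H i\<close> acts on party \<open>i\<close>. Let \<open>N\<close> be the traceless part of \<open>H k\<close>. If party \<open>k\<close> is maximally mixed
  and uncorrelated with every other party, the expectation of \<open>N (\<Sum>i. H i)\<close> in \<open>\<psi>\<close> vanishes, and so do its
  terms with \<open>i \<noteq> k\<close>; what remains is \<open>tr (N\<^sup>2) = 0\<close>. The representations need not be unitary, so
  \<open>N\<close> need not be normal, but \<open>2\<pi>\<close>-periodicity forces the eigenvalues of \<open>H k\<close> to be imaginary and
  \<open>H k\<close> to be diagonalizable. Hence \<open>N = 0\<close>, and \<open>R k\<close> acts by scalars of modulus one.
\<close>

unbundle no vec_syntax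
hide_const (open) Finite_Cartesian_Product.mat Finite_Cartesian_Product.row
  Finite_Cartesian_Product.vec Finite_Cartesian_Product.transpose
hide_type (open) Finite_Cartesian_Product.vec

section \<open>Matrices\<close>

lemma mult_mat_entry:
  assumes "A \<in> carrier_mat m m" "B \<in> carrier_mat m m" "i < m" "j < m"
  shows "(A * B) $$ (i, j) = (\<Sum>k<m. A $$ (i, k) * B $$ (k, j))"
  using assms by (simp add: scalar_prod_def atLeast0LessThan)

lemma mult_mat_zero_vec:
  fixes A :: "'a::comm_ring_1 mat"
  shows "A \<in> carrier_mat m n \<Longrightarrow> A *\<^sub>v 0\<^sub>v n = 0\<^sub>v m"
  by (intro eq_vecI) auto

lemma trace_mult_commute:
  fixes A B :: "'a::comm_semiring_0 mat"
  assumes "A \<in> carrier_mat m m" "B \<in> carrier_mat m m"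
  shows "(\<Sum>i<m. (A * B) $$ (i, i)) = (\<Sum>i<m. (B * A) $$ (i, i))"
proof -
  have "(\<Sum>i<m. (A * B) $$ (i, i)) = (\<Sum>i<m. \<Sum>j<m. A $$ (i, j) * B $$ (j, i))"
    using assms by (simp add: mult_mat_entry del: index_mult_mat)
  also have "\<dots> = (\<Sum>j<m. \<Sum>i<m. B $$ (j, i) * A $$ (i, j))"
    by (subst sum.swap) (simp add: mult.commute)
  also have "\<dots> = (\<Sum>j<m. (B * A) $$ (j, j))"
    using assms by (simp add: mult_mat_entry del: index_mult_mat)
  finally show ?thesis .
qed

lemma trace_similar:
  fixes A B :: "'a::comm_ring_1 mat"
  assumes "A \<in> carrier_mat m m" "similar_mat_wit A B P Q"
  shows "(\<Sum>i<m. A $$ (i, i)) = (\<Sum>i<m. B $$ (i, i))"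
proof -
  note w = similar_mat_witD2[OF assms]
  have "(\<Sum>i<m. A $$ (i, i)) = (\<Sum>i<m. (P * (B * Q)) $$ (i, i))"
    using w by (simp add: assoc_mult_mat[of _ m m _ m _ m])
  also have "\<dots> = (\<Sum>i<m. ((B * Q) * P) $$ (i, i))"
    using w by (intro trace_mult_commute) auto
  also have "(B * Q) * P = B"
    using w by (simp add: assoc_mult_mat[of _ m m _ m _ m])
  finally show ?thesis .
qed

lemma minus_scalar_mult_vec:
  fixes H :: "'a::comm_ring_1 mat"
  assumes "H \<in> carrier_mat m m" "v \<in> carrier_vec m"
  shows "(H - \<mu> \<cdot>\<^sub>m 1\<^sub>m m) *\<^sub>v v = H *\<^sub>v v - \<mu> \<cdot>\<^sub>v v"
proof -
  have "(\<mu> \<cdot>\<^sub>m 1\<^sub>m m) *\<^sub>v v = \<mu> \<cdot>\<^sub>v v"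
    using assms(2) by (intro eq_vecI) auto
  then show ?thesis
    using assms by (simp add: minus_mult_distrib_mat_vec[of _ m m])
qed

lemma minus_scalar_carrier:
  "(H - \<mu> \<cdot>\<^sub>m 1\<^sub>m m) \<in> carrier_mat m m"
  by (intro minus_carrier_mat smult_carrier_mat one_carrier_mat)

text \<open>By the Leibniz formula the determinant is a polynomial in the entries. This is used to
  find an invertible matrix among approximations of the identity.\<close>

lemma det_tendsto:
  fixes A :: "'b \<Rightarrow> nat \<Rightarrow> nat \<Rightarrow> complex"
  assumes "\<And>i j. i < m \<Longrightarrow> j < m \<Longrightarrow> ((\<lambda>e. A e i j) \<longlongrightarrow> L i j) F"
  shows "((\<lambda>e. det (mat m m (\<lambda>(i, j). A e i j))) \<longlongrightarrow> det (mat m m (\<lambda>(i, j). L i j))) F"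
proof -
  have less: "p i < m" if "p permutes {0..<m}" "i < m" for p :: "nat \<Rightarrow> nat" and i
    using permutes_in_image[OF that(1), of i] that(2) by simp
  have det_mat: "det (mat m m (\<lambda>(i, j). f i j)) =
      (\<Sum>p\<in>{p. p permutes {0..<m}}. signof p * (\<Prod>i = 0..<m. f i (p i)))"
    for f :: "nat \<Rightarrow> nat \<Rightarrow> complex"
    by (subst det_def'[of _ m])
      (auto intro!: sum.cong prod.cong simp: less)
  show ?thesis
    unfolding det_mat
    by (intro tendsto_intros assms) (auto simp: less)
qed

section \<open>Matrices forced to vanish by their traces and semisimplicity at 0\<close>

text \<open>Such a \<open>B\<close> is nilpotent, and \<open>semisimple\<close> rules out nontrivial
  nilpotent behaviour. Column \<open>j\<close> is \<open>B\<close> applied to a unit vector;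
  applying \<open>B\<close> once more combines only columns with index below \<open>j\<close>, which
  vanish by induction.\<close>

lemma strictly_upper_triangular_eq_0:
  fixes B :: "'a::semidom mat"
  assumes B: "B \<in> carrier_mat m m"
    and upper: "\<And>i j. j < m \<Longrightarrow> i < m \<Longrightarrow> j \<le> i \<Longrightarrow> B $$ (i, j) = 0"
    and semisimple: "\<And>v. v \<in> carrier_vec m \<Longrightarrow> B *\<^sub>v (B *\<^sub>v v) = 0\<^sub>v m \<Longrightarrow> B *\<^sub>v v = 0\<^sub>v m"
  shows "B = 0\<^sub>m m m"
proof -
  have "\<forall>i<m. B $$ (i, j) = 0" if "j < m" for j
    using that
  proof (induction j rule: less_induct)
    case (less j)
    have unit: "B *\<^sub>v unit_vec m j = col B j"
      using B less.prems by (intro eq_vecI) (auto simp: scalar_prod_right_unit)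
    have "B *\<^sub>v col B j = 0\<^sub>v m"
    proof (rule eq_vecI)
      fix i assume "i < dim_vec (0\<^sub>v m)"
      then have i: "i < m" by simp
      have "B $$ (i, k) * B $$ (k, j) = 0" if "k < m" for k
        using less.IH[of k] upper[of j k] that less.prems i by (cases "k < j") auto
      then show "(B *\<^sub>v col B j) $ i = 0\<^sub>v m $ i"
        using B less.prems i by (auto simp: scalar_prod_def intro!: sum.neutral)
    qed (use B in auto)
    then have "B *\<^sub>v unit_vec m j = 0\<^sub>v m"
      using semisimple[of "unit_vec m j"] by (simp add: unit)
    then have "col B j = 0\<^sub>v m"
      by (simp add: unit)
    then have "col B j $ i = 0" if "i < m" for i
      using that by simp
    then show ?case
      using B less.prems by simp
  qed
  then show ?thesis
    using B by (intro eq_matI) auto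
qed

text \<open>All eigenvalues share the real part \<open>r\<close>, so the zero trace gives
  \<open>r = 0\<close>. The trace of \<open>N * N\<close> is then minus a sum of squared imaginary
  parts, so every eigenvalue is 0, and the remaining nilpotent matrix is killed by
  \<open>semisimple\<close>. The guard \<open>eigenvalue N 0\<close> is there because the period
  condition needed to establish \<open>semisimple\<close> is available only from actual
  eigenvalues.\<close>

lemma traceless_semisimple_eq_0:
  fixes N :: "complex mat"
  assumes N: "N \<in> carrier_mat m m"
    and tr: "(\<Sum>i<m. N $$ (i, i)) = 0"
    and tr2: "(\<Sum>i<m. (N * N) $$ (i, i)) = 0"
    and line: "\<And>\<nu>. eigenvalue N \<nu> \<Longrightarrow> Re \<nu> = r"
    and semisimple: "\<And>v. v \<in> carrier_vec m \<Longrightarrow> eigenvalue N 0 \<Longrightarrow> 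
      N *\<^sub>v (N *\<^sub>v v) = 0\<^sub>v m \<Longrightarrow> N *\<^sub>v v = 0\<^sub>v m"
  shows "N = 0\<^sub>m m m"
proof (cases "m = 0")
  case True
  then show ?thesis using N by auto
next
  case False
  obtain es where es: "char_poly N = (\<Prod>a\<leftarrow>es. [:- a, 1:])"
    using char_poly_factorized[OF N] by blast
  obtain B where B: "B \<in> carrier_mat m m" "upper_triangular B" "similar_mat N B"
    using schur_upper_triangular[OF N es] by blast
  then obtain P Q where wit: "similar_mat_wit N B P Q"
    unfolding similar_mat_def by blast
  note w = similar_mat_witD2[OF N wit]
  have ev: "eigenvalue N (B $$ (i, i))" if "i < m" for i
  proof -
    have "poly (char_poly B) (B $$ (i, i)) = 0"
      unfolding char_poly_upper_triangular[OF B(1,2)] poly_prod_list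
      using B(1) that by (force simp: prod_list_zero_iff diag_mat_def)
    then show ?thesis
      using eigenvalue_root_char_poly[OF N] char_poly_similar[OF B(3)] by simp
  qed
  have "(\<Sum>i<m. B $$ (i, i)) = 0"
    using trace_similar[OF N wit] tr by simp
  moreover have "Re (\<Sum>i<m. B $$ (i, i)) = of_nat m * r"
    using line[OF ev] by simp
  ultimately have r: "r = 0"
    using False by simp
  have "similar_mat_wit (N * N) (B * B) P Q"
    using similar_mat_wit_pow[OF wit, of 2] N B(1) by (simp add: numeral_2_eq_2)
  then have "(\<Sum>i<m. (B * B) $$ (i, i)) = 0"
    using trace_similar[of "N * N" m "B * B" P Q] N tr2 by simp
  moreover have "(B * B) $$ (i, i) = - of_real ((Im (B $$ (i, i)))\<^sup>2)" if "i < m" for i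
  proof -
    have "(B * B) $$ (i, i) = (\<Sum>j = 0..<m. B $$ (i, j) * B $$ (j, i))"
      using B(1) that by (simp add: scalar_prod_def)
    \<comment> \<open>For \<open>j \<noteq> i\<close>, one of the two factors lies below the
      diagonal.\<close>
    also have "\<dots> = (\<Sum>j = 0..<m. if j = i then (B $$ (i, i))\<^sup>2 else 0)"
    proof (intro sum.cong refl)
      fix j assume "j \<in> {0..<m}"
      then show "B $$ (i, j) * B $$ (j, i) = (if j = i then (B $$ (i, i))\<^sup>2 else 0)"
        using B(1,2) that unfolding upper_triangular_def
        by (cases i j rule: linorder_cases) (auto simp: power2_eq_square)
    qed
    also have "\<dots> = (B $$ (i, i))\<^sup>2"
      using that by simp
    also have "\<dots> = - of_real ((Im (B $$ (i, i)))\<^sup>2)"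
      using line[OF ev[OF that]] r by (simp add: complex_eq_iff power2_eq_square)
    finally show ?thesis .
  qed
  ultimately have "(\<Sum>i<m. of_real ((Im (B $$ (i, i)))\<^sup>2) :: complex) = 0"
    by (simp add: sum_negf)
  then have "(\<Sum>i<m. (Im (B $$ (i, i)))\<^sup>2) = 0"
    unfolding of_real_sum[symmetric] of_real_eq_0_iff .
  then have "\<forall>i<m. Im (B $$ (i, i)) = 0"
    by (simp add: sum_nonneg_eq_0_iff)
  then have diag: "B $$ (i, i) = 0" if "i < m" for i
    using line[OF ev[OF that]] r that by (simp add: complex_eq_iff)
  \<comment> \<open>Since \<open>m > 0\<close> there is a diagonal entry to serve as this
    eigenvalue, which discharges the guard of \<open>semisimple\<close>.\<close>
  have "eigenvalue N 0"
    using ev[of 0] diag[of 0] False by simp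
  note semisimple = semisimple[OF _ this]
  have "B = 0\<^sub>m m m"
  proof (rule strictly_upper_triangular_eq_0[OF B(1)])
    fix i j assume "j < m" "i < m" "j \<le> i"
    then show "B $$ (i, j) = 0"
      using diag B(1,2) unfolding upper_triangular_def by (cases "i = j") auto
  next
    fix v :: "complex vec" assume v: "v \<in> carrier_vec m" "B *\<^sub>v (B *\<^sub>v v) = 0\<^sub>v m"
    \<comment> \<open>\<open>P\<close> intertwines \<open>B\<close> with \<open>N\<close>, so the
      semisimplicity of \<open>N\<close> passes to \<open>B\<close>.\<close>
    have "N * P = P * B * (Q * P)"
      unfolding w(3) using w(5-7) by (intro assoc_mult_mat[of _ m m _ m _ m]) auto
    then have "N * P = P * B"
      using w(5,6) by (simp add: w(2))
    then have NP: "N *\<^sub>v (P *\<^sub>v u) = P *\<^sub>v (B *\<^sub>v u)" if "u \<in> carrier_vec m" for u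
      using assoc_mult_mat_vec[OF w(4,6) that] assoc_mult_mat_vec[OF w(6,5) that] by simp
    have QP: "Q *\<^sub>v (P *\<^sub>v u) = u" if "u \<in> carrier_vec m" for u
      using assoc_mult_mat_vec[OF w(7,6) that] that by (simp add: w(2))
    have "N *\<^sub>v (N *\<^sub>v (P *\<^sub>v v)) = P *\<^sub>v (B *\<^sub>v (B *\<^sub>v v))"
      using NP[OF v(1)] NP[of "B *\<^sub>v v"] v(1) B(1) by simp
    also have "\<dots> = 0\<^sub>v m"
      using w(6) by (simp add: v(2) mult_mat_zero_vec)
    finally have "P *\<^sub>v (B *\<^sub>v v) = 0\<^sub>v m"
      using semisimple[of "P *\<^sub>v v"] w(6) v(1) NP[OF v(1)] by simp
    then show "B *\<^sub>v v = 0\<^sub>v m"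
      using QP[of "B *\<^sub>v v"] w(5,7) v(1) by (simp add: mult_mat_zero_vec)
  qed
  then show ?thesis
    using w(3,6,7) by simp
qed

section \<open>Continuous one-parameter groups of matrices with period \<open>2\<pi>\<close>\<close>

lemma has_vector_derivative_quotient_tendsto:
  fixes f :: "real \<Rightarrow> complex"
  assumes "(f has_vector_derivative f') (at 0)"
  shows "((\<lambda>h. (f h - f 0) / of_real h) \<longlongrightarrow> f') (at 0)"
proof -
  have lim: "(\<lambda>h. norm (f h - f 0 - h *\<^sub>R f') / norm h) \<midarrow>0\<rightarrow> 0"
    using assms unfolding has_vector_derivative_def has_derivative_at by simp
  have "norm (f h - f 0 - h *\<^sub>R f') / norm h = norm ((f h - f 0) / of_real h - f')" if "h \<noteq> 0" for h
  proof -
    have "(f h - f 0) / of_real h - f' = (f h - f 0 - h *\<^sub>R f') / of_real h"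
      using that by (simp add: field_simps scaleR_conv_of_real)
    then show ?thesis
      by (simp add: norm_divide)
  qed
  then have "(\<lambda>h. norm ((f h - f 0) / of_real h - f')) \<midarrow>0\<rightarrow> 0"
    by (intro Lim_transform_eventually[OF lim]) (simp add: eventually_at_filter)
  then show ?thesis
    by (rule LIM_zero_cancel[OF tendsto_norm_zero_cancel])
qed

lemma vector_derivative_zero_imp_eq:
  fixes f :: "real \<Rightarrow> complex"
  assumes "\<And>t. (f has_vector_derivative 0) (at t)"
  shows "f s = f t"
proof -
  obtain c where "\<And>x. x \<in> UNIV \<Longrightarrow> f x = c"
    using has_vector_derivative_zero_constant[of UNIV f] assms by auto
  then show ?thesis by simp
qed

text \<open>The group is parametrised by the real line so that real derivatives apply. Only
  \<open>period\<close> remembers the circle; it is what constrains the eigenvalues and excludes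
  Jordan blocks.\<close>

locale circle_matrix_group =
  fixes m :: nat and F :: "real \<Rightarrow> complex mat"
  assumes carrier: "F t \<in> carrier_mat m m"
    and zero: "F 0 = 1\<^sub>m m"
    and add: "F (s + t) = F s * F t"
    and cont: "i < m \<Longrightarrow> j < m \<Longrightarrow> continuous_on UNIV (\<lambda>t. F t $$ (i, j))"
    and period: "F (2 * pi) = 1\<^sub>m m"
begin

text \<open>The differential equation is required at every \<open>t\<close>, not only at 0, because
  the later arguments find quantities that are constant along the whole orbit.\<close>

definition is_generator :: "complex mat \<Rightarrow> bool" where
  "is_generator H \<longleftrightarrow> H \<in> carrier_mat m m \<and>
     (\<forall>t. \<forall>i<m. \<forall>j<m. ((\<lambda>s. F s $$ (i, j)) has_vector_derivative (F t * H) $$ (i, j)) (at t))"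

lemma entry_add:
  "i < m \<Longrightarrow> j < m \<Longrightarrow> F (s + t) $$ (i, j) = (\<Sum>k<m. F s $$ (i, k) * F t $$ (k, j))"
  using carrier[of s] carrier[of t] by (simp add: add scalar_prod_def atLeast0LessThan)

text \<open>If \<open>\<Phi>\<close> is an entrywise antiderivative of \<open>F\<close>, then \<open>F t * (\<Phi> e - \<Phi> 0) = \<Phi> (t + e) - \<Phi> t\<close>,
  and \<open>\<Phi> e - \<Phi> 0\<close> is invertible for small \<open>e \<noteq> 0\<close>; hence \<open>F\<close> inherits the smoothness of \<open>\<Phi>\<close>.\<close>

lemma ex_generator: "\<exists>H. is_generator H"
proof -
  have "\<exists>G. \<forall>x. i < m \<longrightarrow> j < m \<longrightarrow> (G has_vector_derivative F x $$ (i, j)) (at x)" for i j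
  proof (cases "i < m \<and> j < m")
    case True
    then show ?thesis
      using einterval_antiderivative[of "-\<infinity>" \<infinity> "\<lambda>t. F t $$ (i, j)"] cont[of i j]
      by (auto simp: continuous_on_eq_continuous_at)
  qed auto
  then have "\<forall>i j. \<exists>G. \<forall>x. i < m \<longrightarrow> j < m \<longrightarrow> (G has_vector_derivative F x $$ (i, j)) (at x)"
    by blast
  then obtain \<Phi> where \<Phi>: "\<And>i j x. i < m \<Longrightarrow> j < m \<Longrightarrow>
      (\<Phi> i j has_vector_derivative F x $$ (i, j)) (at x)"
    unfolding choice_iff by blast
  define D where "D e = Matrix.mat m m (\<lambda>(i, j). \<Phi> i j e - \<Phi> i j 0)" for e
  have D: "D e \<in> carrier_mat m m" for e
    by (simp add: D_def)
  have FD: "(F t * D e) $$ (i, j) = \<Phi> i j (t + e) - \<Phi> i j t" if ij: "i < m" "j < m" for t e i j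
  proof -
    \<comment> \<open>The defect of the claimed identity, up to a constant. Its derivative is an
      entry of \<open>F t * F s - F (t + s)\<close>, hence zero by the group law.\<close>
    define f where "f s = (\<Sum>k<m. F t $$ (i, k) * \<Phi> k j s) - \<Phi> i j (t + s)" for s
    have "(f has_vector_derivative 0) (at s)" for s
    proof -
      have "((\<lambda>s. \<Phi> i j (t + s)) has_vector_derivative 1 *\<^sub>R (F (t + s) $$ (i, j))) (at s)"
        unfolding o_def[of "\<Phi> i j" "\<lambda>s. t + s", symmetric]
        by (intro vector_diff_chain_at \<Phi> ij) (auto intro!: derivative_eq_intros)
      then have "(f has_vector_derivative
          (\<Sum>k<m. F t $$ (i, k) * F s $$ (k, j)) - 1 *\<^sub>R (F (t + s) $$ (i, j))) (at s)"
        unfolding f_def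
        by (intro has_vector_derivative_diff has_vector_derivative_sum
              has_vector_derivative_mult_right \<Phi>) (use ij in auto)
      then show ?thesis
        by (simp add: entry_add[OF ij])
    qed
    then have "f e = f 0"
      by (rule vector_derivative_zero_imp_eq)
    then have "(\<Sum>k<m. F t $$ (i, k) * \<Phi> k j e) - (\<Sum>k<m. F t $$ (i, k) * \<Phi> k j 0)
        = \<Phi> i j (t + e) - \<Phi> i j t"
      by (simp add: f_def algebra_simps)
    moreover have "(F t * D e) $$ (i, j) =
        (\<Sum>k<m. F t $$ (i, k) * \<Phi> k j e) - (\<Sum>k<m. F t $$ (i, k) * \<Phi> k j 0)"
      using carrier[of t] ij
      by (simp add: D_def scalar_prod_def atLeast0LessThan algebra_simps flip: sum_subtractf)
    ultimately show ?thesis by simp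
  qed
  \<comment> \<open>The difference quotients of \<open>\<Phi>\<close> at 0 tend to
    \<open>F 0\<close>, the identity, so their determinant tends to 1 and is nonzero for some
    \<open>e\<close>.\<close>
  have "((\<lambda>e. det (Matrix.mat m m (\<lambda>(i, j). (\<Phi> i j e - \<Phi> i j 0) / of_real e))) \<longlongrightarrow>
      det (Matrix.mat m m (\<lambda>(i, j). F 0 $$ (i, j)))) (at 0)"
    by (intro det_tendsto has_vector_derivative_quotient_tendsto \<Phi>)
  moreover have "Matrix.mat m m (\<lambda>(i, j). F 0 $$ (i, j)) = 1\<^sub>m m"
    using zero by (intro eq_matI) auto
  ultimately have "\<forall>\<^sub>F e in at 0.
      det (Matrix.mat m m (\<lambda>(i, j). (\<Phi> i j e - \<Phi> i j 0) / of_real e)) \<noteq> 0"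
    by (intro tendsto_imp_eventually_ne) auto
  then obtain e :: real where
    e: "det (Matrix.mat m m (\<lambda>(i, j). (\<Phi> i j e - \<Phi> i j 0) / of_real e)) \<noteq> 0"
    using eventually_happens trivial_limit_at by blast
  have "Matrix.mat m m (\<lambda>(i, j). (\<Phi> i j e - \<Phi> i j 0) / of_real e) = (1 / of_real e) \<cdot>\<^sub>m D e"
    by (intro eq_matI) (auto simp: D_def)
  then have "det (D e) \<noteq> 0"
    using e by auto
  then obtain V where V: "V \<in> carrier_mat m m" "D e * V = 1\<^sub>m m"
    using det_non_zero_imp_unit[OF D] unfolding Units_def ring_mat_def by auto
  \<comment> \<open>Differentiating \<open>F t * D e = \<Phi> (t + e) - \<Phi> t\<close> gives
    \<open>F (t + e) - F t = F t * (F e - 1)\<close> on the right; multiplying by the right inverse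
    \<open>V\<close> of \<open>D e\<close> isolates the derivative of \<open>F\<close>.\<close>
  define H where "H = (F e - 1\<^sub>m m) * V"
  have H: "H \<in> carrier_mat m m"
    using V carrier[of e] by (auto simp: H_def)
  have "((\<lambda>s. F s $$ (i, j)) has_vector_derivative (F t * H) $$ (i, j)) (at t)"
    if ij: "i < m" "j < m" for i j t
  proof -
    have F: "F s $$ (i, j) = (\<Sum>k<m. (\<Phi> i k (s + e) - \<Phi> i k s) * V $$ (k, j))" for s
    proof -
      have "F s = F s * D e * V"
        using assoc_mult_mat[OF carrier D V(1), of s e] V(2) carrier[of s] by simp
      then have "F s $$ (i, j) = ((F s * D e) * V) $$ (i, j)"
        by simp
      also have "\<dots> = (\<Sum>k<m. (F s * D e) $$ (i, k) * V $$ (k, j))"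
        using V(1) ij mult_carrier_mat[OF carrier D, of s e]
        by (intro mult_mat_entry) auto
      also have "\<dots> = (\<Sum>k<m. (\<Phi> i k (s + e) - \<Phi> i k s) * V $$ (k, j))"
        using ij by (intro sum.cong) (auto simp: FD)
      finally show ?thesis .
    qed
    have "((\<lambda>s. \<Phi> i k (s + e)) has_vector_derivative 1 *\<^sub>R (F (t + e) $$ (i, k))) (at t)"
      if "k < m" for k
      unfolding o_def[of "\<Phi> i k" "\<lambda>s. s + e", symmetric]
      by (intro vector_diff_chain_at \<Phi> ij that) (auto intro!: derivative_eq_intros)
    then have "((\<lambda>s. F s $$ (i, j)) has_vector_derivative
        (\<Sum>k<m. (1 *\<^sub>R (F (t + e) $$ (i, k)) - F t $$ (i, k)) * V $$ (k, j))) (at t)"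
      unfolding F
      by (intro has_vector_derivative_diff has_vector_derivative_sum
            has_vector_derivative_mult_left \<Phi>) (use ij in auto)
    moreover have "F t * H = (F (t + e) - F t) * V"
      using V(1) carrier[of t] carrier[of e]
      by (simp add: H_def add mult_minus_distrib_mat minus_carrier_mat
          flip: assoc_mult_mat[of _ m m _ m _ m])
    then have "(F t * H) $$ (i, j) =
        (\<Sum>k<m. (1 *\<^sub>R (F (t + e) $$ (i, k)) - F t $$ (i, k)) * V $$ (k, j))"
      using V(1) carrier[of t] carrier[of "t + e"] ij
      by (simp add: scalar_prod_def atLeast0LessThan)
    ultimately show ?thesis by simp
  qed
  then show ?thesis
    using H unfolding is_generator_def by blast
qed

lemma orbit_derivative:
  assumes H: "is_generator H" and v: "v \<in> carrier_vec m" and i: "i < m"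
  shows "((\<lambda>s. (F s *\<^sub>v v) $ i) has_vector_derivative (F t *\<^sub>v (H *\<^sub>v v)) $ i) (at t)"
proof -
  have Hc: "H \<in> carrier_mat m m"
    using H by (simp add: is_generator_def)
  have *: "(A *\<^sub>v v) $ i = (\<Sum>k<m. A $$ (i, k) * v $ k)" if "A \<in> carrier_mat m m" for A
    using that v i by (simp add: scalar_prod_def atLeast0LessThan)
  have "((\<lambda>s. \<Sum>k<m. F s $$ (i, k) * v $ k) has_vector_derivative
      (\<Sum>k<m. (F t * H) $$ (i, k) * v $ k)) (at t)"
    using H i unfolding is_generator_def
    by (intro has_vector_derivative_sum has_vector_derivative_mult_left) auto
  moreover have "F t *\<^sub>v (H *\<^sub>v v) = (F t * H) *\<^sub>v v"
    using carrier[of t] Hc v by simp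
  ultimately show ?thesis
    using *[OF carrier] *[of "F t * H"] carrier[of t] Hc by auto
qed

text \<open>The exponential factor shifts the generator from \<open>H\<close> to
  \<open>H - \<mu>\<close>. Hence twisted orbits are constant on the kernel of
  \<open>H - \<mu>\<close> and affine in time on the kernel of its square.\<close>

lemma twisted_orbit_derivative:
  assumes H: "is_generator H" and v: "v \<in> carrier_vec m" and i: "i < m"
  shows "((\<lambda>s. exp (- (of_real s * \<mu>)) * (F s *\<^sub>v v) $ i) has_vector_derivative
    exp (- (of_real t * \<mu>)) * (F t *\<^sub>v ((H - \<mu> \<cdot>\<^sub>m 1\<^sub>m m) *\<^sub>v v)) $ i) (at t)"
proof -
  have Hc: "H \<in> carrier_mat m m"
    using H by (simp add: is_generator_def)
  have "(H - \<mu> \<cdot>\<^sub>m 1\<^sub>m m) *\<^sub>v v = H *\<^sub>v v - \<mu> \<cdot>\<^sub>v v"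
    using Hc v by (simp add: minus_scalar_mult_vec)
  then have "F t *\<^sub>v ((H - \<mu> \<cdot>\<^sub>m 1\<^sub>m m) *\<^sub>v v) = F t *\<^sub>v (H *\<^sub>v v) - \<mu> \<cdot>\<^sub>v (F t *\<^sub>v v)"
    using Hc v carrier[of t] by (simp add: mult_minus_distrib_mat_vec[of _ m m] mult_mat_vec)
  then have entry: "(F t *\<^sub>v ((H - \<mu> \<cdot>\<^sub>m 1\<^sub>m m) *\<^sub>v v)) $ i =
      (F t *\<^sub>v (H *\<^sub>v v)) $ i - \<mu> * (F t *\<^sub>v v) $ i"
    using Hc v i carrier[of t] by simp
  have "((\<lambda>s. exp (- (of_real s * \<mu>))) has_vector_derivative - \<mu> * exp (- (of_real t * \<mu>))) (at t)"
  proof -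
    have "((\<lambda>z. exp (- (z * \<mu>))) has_field_derivative - \<mu> * exp (- (of_real t * \<mu>))) (at (of_real t))"
      by (auto intro!: derivative_eq_intros)
    then show ?thesis
      by (rule has_vector_derivative_real_field)
  qed
  from has_vector_derivative_mult[OF this orbit_derivative[OF H v i, of t]]
  show ?thesis
    by (simp add: entry algebra_simps)
qed

text \<open>The twisted orbit of an eigenvector is constant; comparing the times 0 and
  \<open>2 * pi\<close>, where \<open>F\<close> is the identity, gives the claim.\<close>

lemma eigenvalue_period:
  assumes H: "is_generator H" and ev: "eigenvalue H a"
  shows "exp (2 * of_real pi * a) = 1"
proof -
  have Hc: "H \<in> carrier_mat m m"
    using H by (simp add: is_generator_def)
  obtain v where v: "v \<in> carrier_vec m" "v \<noteq> 0\<^sub>v m" "H *\<^sub>v v = a \<cdot>\<^sub>v v"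
    using ev Hc unfolding eigenvalue_def eigenvector_def by auto
  then obtain i where i: "i < m" "v $ i \<noteq> 0"
    by (auto simp: Matrix.vec_eq_iff)
  have "(H - a \<cdot>\<^sub>m 1\<^sub>m m) *\<^sub>v v = 0\<^sub>v m"
    using Hc v by (simp add: minus_scalar_mult_vec)
  moreover have "(F t *\<^sub>v 0\<^sub>v m) $ i = 0" for t
    using carrier[of t] i by simp
  ultimately have "((\<lambda>s. exp (- (of_real s * a)) * (F s *\<^sub>v v) $ i) has_vector_derivative 0) (at t)" for t
    using twisted_orbit_derivative[OF H v(1) i(1), of a t] by simp
  from vector_derivative_zero_imp_eq[OF this, of "2 * pi" 0]
  have "exp (- (of_real (2 * pi) * a)) * v $ i = v $ i"
    using v i by (simp add: period zero)
  then have "exp (- (2 * of_real pi * a)) = 1"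
    using i by simp
  then show ?thesis
    by (simp add: exp_minus)
qed

text \<open>The twisted orbit \<open>g\<close> of \<open>v\<close> is affine in time with slope
  \<open>N *\<^sub>v v\<close>, entry by entry. The condition on \<mu> makes it return to its
  initial value at \<open>2 * pi\<close>, so the slope is zero.\<close>

lemma generator_semisimple:
  assumes H: "is_generator H" and \<mu>: "exp (2 * of_real pi * \<mu>) = 1"
    and v: "v \<in> carrier_vec m"
    and N: "N = H - \<mu> \<cdot>\<^sub>m 1\<^sub>m m" and NN: "N *\<^sub>v (N *\<^sub>v v) = 0\<^sub>v m"
  shows "N *\<^sub>v v = 0\<^sub>v m"
proof (rule eq_vecI)
  have Hc: "H \<in> carrier_mat m m"
    using H by (simp add: is_generator_def)
  then have Nv: "N *\<^sub>v v \<in> carrier_vec m"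
    using v mult_mat_vec_carrier[OF minus_scalar_carrier] by (simp add: N)
  fix i assume "i < dim_vec (0\<^sub>v m)"
  then have i: "i < m" by simp
  define g where "g s = exp (- (of_real s * \<mu>)) * (F s *\<^sub>v v) $ i" for s
  define h where "h s = exp (- (of_real s * \<mu>)) * (F s *\<^sub>v (N *\<^sub>v v)) $ i" for s
  have dg: "(g has_vector_derivative h t) (at t)" for t
    unfolding g_def h_def N by (rule twisted_orbit_derivative[OF H v i])
  have "(h has_vector_derivative 0) (at t)" for t
    using twisted_orbit_derivative[OF H Nv i, of \<mu> t] NN carrier[of t] i
    unfolding h_def N[symmetric] by simp
  then have "h t = h 0" for t
    by (rule vector_derivative_zero_imp_eq)
  then have h: "h t = (N *\<^sub>v v) $ i" for t
    using Nv by (simp add: h_def zero)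
  have "((\<lambda>s. g s - of_real s * (N *\<^sub>v v) $ i) has_vector_derivative 0) (at t)" for t
  proof -
    have "((\<lambda>s. of_real s * (N *\<^sub>v v) $ i) has_vector_derivative (N *\<^sub>v v) $ i) (at t)"
      by (rule has_vector_derivative_real_field) (auto intro!: derivative_eq_intros)
    from has_vector_derivative_diff[OF dg[of t] this] show ?thesis
      by (simp add: h)
  qed
  from vector_derivative_zero_imp_eq[OF this, of "2 * pi" 0]
  have "g (2 * pi) - of_real (2 * pi) * (N *\<^sub>v v) $ i = g 0"
    by simp
  moreover have "g (2 * pi) = g 0"
    using \<mu> by (simp add: g_def zero period exp_minus)
  ultimately show "(N *\<^sub>v v) $ i = 0\<^sub>v m $ i"
    using i by simp
qed (use assms in \<open>auto simp: is_generator_def\<close>)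

text \<open>An eigenvalue \<nu> of \<open>N\<close> gives the eigenvalue
  \<open>\<mu> + \<nu>\<close> of \<open>H\<close>, which is imaginary by periodicity. So the
  eigenvalues of \<open>N\<close> lie on the line with real part \<open>- Re \<mu>\<close>, as
  \<open>traceless_semisimple_eq_0\<close> demands, and \<open>N = 0\<close> leaves only the scalar
  flow \<open>exp (t * \<mu>)\<close>.\<close>

lemma scalar_if_traces_vanish:
  assumes H: "is_generator H" and N: "N = H - \<mu> \<cdot>\<^sub>m 1\<^sub>m m"
    and "(\<Sum>i<m. N $$ (i, i)) = 0" "(\<Sum>i<m. (N * N) $$ (i, i)) = 0"
  shows "\<exists>c. cmod c = 1 \<and> F t = c \<cdot>\<^sub>m 1\<^sub>m m"
proof (cases "m = 0")
  case True
  then show ?thesis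
    using carrier[of t] by (intro exI[of _ 1]) auto
next
  case False
  have Hc: "H \<in> carrier_mat m m"
    using H by (simp add: is_generator_def)
  have ev: "exp (2 * of_real pi * (\<mu> + \<nu>)) = 1" if ev: "eigenvalue N \<nu>" for \<nu>
  proof (rule eigenvalue_period[OF H])
    obtain v where v: "v \<in> carrier_vec m" "v \<noteq> 0\<^sub>v m" "N *\<^sub>v v = \<nu> \<cdot>\<^sub>v v"
      using ev minus_scalar_carrier[of H \<mu> m] unfolding eigenvalue_def eigenvector_def N by auto
    have "H *\<^sub>v v = \<mu> \<cdot>\<^sub>v v + N *\<^sub>v v"
      using Hc v(1) by (auto simp: N minus_scalar_mult_vec intro!: eq_vecI)
    then have "H *\<^sub>v v = (\<mu> + \<nu>) \<cdot>\<^sub>v v"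
      by (simp add: v(3) add_smult_distrib_vec)
    then show "eigenvalue H (\<mu> + \<nu>)"
      using v Hc unfolding eigenvalue_def eigenvector_def by auto
  qed
  have N0: "N = 0\<^sub>m m m"
  proof (rule traceless_semisimple_eq_0)
    show "Re \<nu> = - Re \<mu>" if "eigenvalue N \<nu>" for \<nu>
      using arg_cong[OF ev[OF that], of cmod] by (simp add: norm_exp_eq_Re)
    show "N *\<^sub>v v = 0\<^sub>v m"
      if "v \<in> carrier_vec m" "eigenvalue N 0" "N *\<^sub>v (N *\<^sub>v v) = 0\<^sub>v m" for v
      using generator_semisimple[OF H _ that(1) N that(3)] ev[OF that(2)] by simp
  qed (use assms minus_scalar_carrier[of H \<mu> m] in auto)
  \<comment> \<open>As \<open>N = 0\<close> and \<open>m > 0\<close>, \<mu> itself satisfies the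
    period condition; therefore it is imaginary and the scalar has modulus one.\<close>
  have "eigenvalue N 0"
    unfolding eigenvalue_def eigenvector_def N0
    by (intro exI[of _ "unit_vec m 0"]) (use False in auto)
  from arg_cong[OF ev[OF this], of cmod] have \<mu>: "Re \<mu> = 0"
    by (simp add: norm_exp_eq_Re)
  have "F t $$ (i, j) = (exp (of_real t * \<mu>) \<cdot>\<^sub>m 1\<^sub>m m) $$ (i, j)" if ij: "i < m" "j < m" for i j
  proof -
    have *: "(F s *\<^sub>v unit_vec m j) $ i = F s $$ (i, j)" for s
      using carrier[of s] ij by (simp add: scalar_prod_right_unit)
    have u: "unit_vec m j \<in> carrier_vec m"
      by simp
    have Nu: "N *\<^sub>v unit_vec m j = 0\<^sub>v m"
      unfolding N0 by (intro eq_vecI) auto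
    have "((\<lambda>s. exp (- (of_real s * \<mu>)) * F s $$ (i, j)) has_vector_derivative 0) (at t)" for t
      using twisted_orbit_derivative[OF H u ij(1), of \<mu> t] carrier[of t] ij
      unfolding * N[symmetric] Nu by (simp add: mult_mat_zero_vec)
    from vector_derivative_zero_imp_eq[OF this, of t 0]
    have "exp (- (of_real t * \<mu>)) * F t $$ (i, j) = 1\<^sub>m m $$ (i, j)"
      by (simp add: zero)
    then show ?thesis
      using ij by (simp add: exp_minus field_simps)
  qed
  then have "F t = exp (of_real t * \<mu>) \<cdot>\<^sub>m 1\<^sub>m m"
    using carrier[of t] by (intro eq_matI) auto
  then show ?thesis
    using \<mu> by (intro exI[of _ "exp (of_real t * \<mu>)"]) simp
qed

end

section \<open>Continuous representations of U(1) and their adjoint action\<close>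

lemma continuous_rep_U1_circle_matrix_group:
  assumes "continuous_rep U1 m \<pi>"
  shows "circle_matrix_group m (\<lambda>t. \<pi> (cis t))"
proof -
  have hom: "\<pi> \<in> hom U1 (GL m)"
    and cont: "\<And>a b. a < m \<Longrightarrow> b < m \<Longrightarrow> continuous_on (carrier U1) (\<lambda>g. \<pi> g $$ (a, b))"
    using assms unfolding continuous_rep_def by auto
  have U1: "cis t \<in> carrier U1" for t
    by (simp add: U1_def)
  have units: "\<pi> (cis t) \<in> Units (ring_mat TYPE(complex) m ())" for t
    using hom_in_carrier[OF hom U1[of t]] by (simp add: GL_def units_of_carrier)
  then have carr: "\<pi> (cis t) \<in> carrier_mat m m" for t
    by (auto simp: Units_def ring_mat_simps)
  have add: "\<pi> (cis (s + t)) = \<pi> (cis s) * \<pi> (cis t)" for s t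
    using hom_mult[OF hom U1[of s] U1[of t]]
    by (simp add: GL_def units_of_mult U1_def ring_mat_simps cis_mult)
  \<comment> \<open>\<open>hom\<close> only provides multiplicativity; the image of the unit is
    idempotent and invertible, hence the identity.\<close>
  have zero: "\<pi> (cis 0) = 1\<^sub>m m"
  proof -
    obtain V where V: "V \<in> carrier_mat m m" "V * \<pi> (cis 0) = 1\<^sub>m m"
      using units[of 0] by (auto simp: Units_def ring_mat_simps)
    have "\<pi> (cis 0) = V * \<pi> (cis 0) * \<pi> (cis 0)"
      unfolding V(2) using carr[of 0] by simp
    also have "\<dots> = V * \<pi> (cis (0 + 0))"
      unfolding add using V(1) carr[of 0] by (intro assoc_mult_mat) auto
    finally show ?thesis
      using V(2) by simp
  qed
  have "continuous_on UNIV (\<lambda>t. \<pi> (cis t) $$ (i, j))" if "i < m" "j < m" for i j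
  proof -
    have "continuous_on UNIV ((\<lambda>g. \<pi> g $$ (i, j)) \<circ> cis)"
      by (intro continuous_on_compose continuous_on_subset[OF cont[OF that]])
        (use U1 in \<open>auto intro!: continuous_intros\<close>)
    then show ?thesis
      by (simp add: o_def)
  qed
  then show ?thesis
    by unfold_locales (use carr add zero in \<open>auto simp flip: cis_2pi\<close>)
qed

lemma mat_adjoint_scalar: "mat_adjoint (c \<cdot>\<^sub>m 1\<^sub>m m) = cnj c \<cdot>\<^sub>m 1\<^sub>m m"
  by (intro eq_matI) (auto simp: mat_adjoint_def mat_of_rows_def)

text \<open>The action uses the conjugate transpose rather than the inverse, so a scalar
  \<open>c\<close> multiplies \<open>X\<close> by \<open>c * cnj c\<close>; this is where modulus
  one enters.\<close>

lemma trivial_adjoint_action_if_scalar: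
  assumes "\<And>t. \<exists>c. cmod c = 1 \<and> \<pi> (cis t) = c \<cdot>\<^sub>m 1\<^sub>m m"
  shows "\<not> nontrivial_adjoint_action U1 m \<pi>"
proof -
  have "\<pi> g * X * mat_adjoint (\<pi> g) = X" if g: "g \<in> carrier U1" and X: "X \<in> carrier_mat m m" for g X
  proof -
    have "g = cis (Arg g)"
      using g cis_Arg[of g] by (cases "g = 0") (auto simp: U1_def sgn_eq)
    then obtain c where c: "cmod c = 1" "\<pi> g = c \<cdot>\<^sub>m 1\<^sub>m m"
      using assms by metis
    have "c * cnj c = 1"
      using c(1) by (simp add: complex_norm_square[symmetric])
    have "c \<cdot>\<^sub>m 1\<^sub>m m * X = c \<cdot>\<^sub>m X"
      using X by (simp add: mult_smult_assoc_mat[of _ m m])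
    moreover have "c \<cdot>\<^sub>m X * (cnj c \<cdot>\<^sub>m 1\<^sub>m m) = cnj c \<cdot>\<^sub>m (c \<cdot>\<^sub>m X)"
      using X by (simp add: mult_smult_distrib[of _ m m _ m])
    moreover have "cnj c \<cdot>\<^sub>m (c \<cdot>\<^sub>m X) = X"
      using \<open>c * cnj c = 1\<close> by (intro eq_matI) (auto simp: mult.commute simp flip: mult.assoc)
    ultimately show ?thesis
      unfolding c(2) mat_adjoint_scalar by simp
  qed
  then show ?thesis
    unfolding nontrivial_adjoint_action_def by blast
qed

section \<open>Local operators on tensors\<close>

lemma finite_multi_index: "finite A \<Longrightarrow> finite (multi_index d A)"
  by (simp add: multi_index_def finite_PiE)

lemma multi_index_upd:
  "a \<in> multi_index d A \<Longrightarrow> i \<in> A \<Longrightarrow> x < d i \<Longrightarrow> a(i := x) \<in> multi_index d A"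
  by (auto simp: multi_index_def PiE_iff extensional_def)

lemma multi_index_less: "a \<in> multi_index d A \<Longrightarrow> i \<in> A \<Longrightarrow> a i < d i"
  by (auto simp: multi_index_def)

lemma sum_multi_index_insert:
  assumes "i \<notin> A"
  shows "(\<Sum>a\<in>multi_index d (insert i A). h a) =
    (\<Sum>x<d i. \<Sum>a\<in>multi_index d A. h (a(i := x)))"
proof -
  have "(\<Sum>a\<in>multi_index d (insert i A). h a) =
      (\<Sum>(x, a)\<in>{0..<d i} \<times> multi_index d A. h (a(i := x)))"
    unfolding multi_index_def PiE_insert_eq
    by (subst sum.reindex[OF inj_combinator[OF assms]]) (simp add: o_def case_prod_unfold)
  then show ?thesis
    by (simp add: sum.cartesian_product atLeast0LessThan)
qed

lemma prod_delta_multi_index: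
  assumes "finite A" "a \<in> multi_index d A" "b \<in> multi_index d A"
  shows "(\<Prod>i\<in>A. if a i = b i then 1 else 0 :: complex) = (if a = b then 1 else 0)"
proof (cases "a = b")
  case False
  then obtain i where "i \<in> A" "a i \<noteq> b i"
    using assms(2,3) unfolding multi_index_def by (metis PiE_ext)
  then show ?thesis
    using False assms(1) by (auto intro!: prod_zero)
qed simp

text \<open>The deltas at the other parties leave only multi-indices that differ from
  \<open>a\<close> at most at \<open>i\<close>. Such sums arise when a tensor product is
  differentiated at the identity: one factor is replaced by its derivative, the others become
  deltas.\<close>

lemma sum_multi_index_one_site:
  assumes P: "finite P" and i: "i \<in> P" and a: "a \<in> multi_index d P"
  shows "(\<Sum>c\<in>multi_index d P. f c * (\<Prod>j\<in>P - {i}. if a j = c j then 1 else 0)) =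
    (\<Sum>x<d i. f (a(i := x)) :: complex)"
proof -
  define Q where "Q = P - {i}"
  have Q: "P = insert i Q" "i \<notin> Q" "finite Q"
    using P i by (auto simp: Q_def)
  have r: "restrict a Q \<in> multi_index d Q"
    using a by (auto simp: multi_index_def Q)
  have upd: "(restrict a Q)(i := x) = a(i := x)" for x
    using a by (auto simp: multi_index_def Q PiE_iff extensional_def fun_eq_iff)
  have "(\<Sum>c\<in>multi_index d P. f c * (\<Prod>j\<in>Q. if a j = c j then 1 else 0)) =
      (\<Sum>x<d i. \<Sum>e\<in>multi_index d Q. f (e(i := x)) *
        (\<Prod>j\<in>Q. if a j = (e(i := x)) j then 1 else 0))"
    unfolding Q(1) by (rule sum_multi_index_insert[OF Q(2)])
  also have "\<dots> = (\<Sum>x<d i. \<Sum>e\<in>multi_index d Q. if e = restrict a Q then f (e(i := x)) else 0)"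
  proof (intro sum.cong refl)
    fix x e assume e: "e \<in> multi_index d Q"
    have "(\<Prod>j\<in>Q. if a j = (e(i := x)) j then 1 else 0 :: complex) =
        (\<Prod>j\<in>Q. if restrict a Q j = e j then 1 else 0)"
      using Q(2) by (intro prod.cong) auto
    also have "\<dots> = (if restrict a Q = e then 1 else 0)"
      by (rule prod_delta_multi_index[OF Q(3) r e])
    finally show "f (e(i := x)) * (\<Prod>j\<in>Q. if a j = (e(i := x)) j then 1 else 0) =
        (if e = restrict a Q then f (e(i := x)) else 0)"
      by auto
  qed
  also have "\<dots> = (\<Sum>x<d i. f ((restrict a Q)(i := x)))"
    using r finite_multi_index[OF Q(3)] by (intro sum.cong refl) simp
  also have "\<dots> = (\<Sum>x<d i. f (a(i := x)))"
    by (simp only: upd)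
  finally show ?thesis
    unfolding Q_def .
qed

section \<open>Operators acting on a single party\<close>

definition apply_local :: "(nat \<Rightarrow> nat) \<Rightarrow> nat \<Rightarrow> complex mat \<Rightarrow> tensor_vec \<Rightarrow> tensor_vec" where
  "apply_local d i Y \<phi> = (\<lambda>a. \<Sum>x<d i. Y $$ (a i, x) * \<phi> (a(i := x)))"

lemma apply_local_one:
  "a \<in> multi_index d P \<Longrightarrow> i \<in> P \<Longrightarrow> apply_local d i (1\<^sub>m (d i)) \<phi> a = \<phi> a"
  using multi_index_less[of a d P i]
  by (simp add: apply_local_def if_distrib[of "\<lambda>z. z * _"] cong: if_cong)

lemma apply_local_cong:
  assumes "a \<in> multi_index d P" "i \<in> P" "\<And>b. b \<in> multi_index d P \<Longrightarrow> \<phi> b = \<chi> b"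
  shows "apply_local d i Y \<phi> a = apply_local d i Y \<chi> a"
  unfolding apply_local_def using assms by (intro sum.cong refl) (simp add: multi_index_upd)

lemma apply_local_sum:
  "apply_local d i Y (\<lambda>a. \<Sum>l\<in>A. \<phi> l a) a = (\<Sum>l\<in>A. apply_local d i Y (\<phi> l) a)"
  unfolding apply_local_def by (simp add: sum_distrib_left) (rule sum.swap)

lemma apply_local_scale:
  "apply_local d i Y (\<lambda>a. c * \<phi> a) a = c * apply_local d i Y \<phi> a"
  unfolding apply_local_def by (simp add: sum_distrib_left mult.left_commute)

lemma apply_local_mult:
  assumes "Y \<in> carrier_mat (d i) (d i)" "Z \<in> carrier_mat (d i) (d i)"
    and "a \<in> multi_index d P" "i \<in> P"
  shows "apply_local d i Y (apply_local d i Z \<phi>) a = apply_local d i (Y * Z) \<phi> a"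
proof -
  have "apply_local d i Y (apply_local d i Z \<phi>) a =
      (\<Sum>x<d i. \<Sum>z<d i. Y $$ (a i, x) * Z $$ (x, z) * \<phi> (a(i := z)))"
    by (simp add: apply_local_def sum_distrib_left mult.assoc)
  also have "\<dots> = (\<Sum>z<d i. (\<Sum>x<d i. Y $$ (a i, x) * Z $$ (x, z)) * \<phi> (a(i := z)))"
    by (subst sum.swap) (simp add: sum_distrib_right)
  also have "\<dots> = apply_local d i (Y * Z) \<phi> a"
    unfolding apply_local_def
    using mult_mat_entry[OF assms(1,2)] multi_index_less[OF assms(3,4)]
    by (intro sum.cong refl) simp
  finally show ?thesis .
qed

section \<open>The generators acting on an invariant state\<close>

lemma has_vector_derivative_prod:
  fixes f :: "'i \<Rightarrow> real \<Rightarrow> complex"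
  assumes "\<And>i. i \<in> I \<Longrightarrow> (f i has_vector_derivative f' i) (at x)"
  shows "((\<lambda>x. \<Prod>i\<in>I. f i x) has_vector_derivative
    (\<Sum>i\<in>I. f' i * (\<Prod>j\<in>I - {i}. f j x))) (at x)"
proof -
  have "((\<lambda>x. \<Prod>i\<in>I. f i x) has_derivative
      (\<lambda>y. \<Sum>i\<in>I. (y *\<^sub>R f' i) * (\<Prod>j\<in>I - {i}. f j x))) (at x)"
    using assms unfolding has_vector_derivative_def by (intro has_derivative_prod) auto
  then show ?thesis
    unfolding has_vector_derivative_def by (simp add: scaleR_sum_right)
qed

lemma pure_state_inner: "pure_state d P \<psi> \<Longrightarrow> (\<Sum>a\<in>multi_index d P. cnj (\<psi> a) * \<psi> a) = 1"
proof -
  assume "pure_state d P \<psi>"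
  then have "complex_of_real (\<Sum>a\<in>multi_index d P. (cmod (\<psi> a))\<^sup>2) = 1"
    by (simp add: pure_state_def)
  then show ?thesis
    by (simp add: complex_norm_square mult.commute flip: of_real_power)
qed

text \<open>Invariance fixes the orbit of \<psi> only up to a phase, so the projector is
  differentiated instead of the vector. With \<open>K\<close> the derivative of the orbit at 0, this
  gives \<open>K a * cnj (\<psi> b) + \<psi> a * cnj (K b) = 0\<close>, and contraction with \<psi>
  shows that \<open>K\<close> is a multiple of \<psi>.\<close>

lemma invariant_state_generator:
  assumes P: "finite P" and pure: "pure_state d P \<psi>" and inv: "invariant_state U1 d P R \<psi>"
    and grp: "\<And>i. i \<in> P \<Longrightarrow> circle_matrix_group (d i) (\<lambda>t. R i (cis t))"
    and H: "\<And>i. i \<in> P \<Longrightarrow>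
      circle_matrix_group.is_generator (d i) (\<lambda>t. R i (cis t)) (H i)"
  shows "\<exists>c. \<forall>a\<in>multi_index d P. (\<Sum>i\<in>P. apply_local d i (H i) \<psi> a) = c * \<psi> a"
proof -
  let ?M = "multi_index d P"
  \<comment> \<open>The image of \<psi> under the tensor product of the matrices
    \<open>R i (cis t)\<close>.\<close>
  define \<phi> where "\<phi> t a = (\<Sum>c\<in>?M. (\<Prod>i\<in>P. R i (cis t) $$ (a i, c i)) * \<psi> c)" for t a
  define K where "K a = (\<Sum>i\<in>P. apply_local d i (H i) \<psi> a)" for a
  have proj: "\<phi> t a * cnj (\<phi> t b) = \<psi> a * cnj (\<psi> b)" if "a \<in> ?M" "b \<in> ?M" for t a b
  proof -
    have "cis t \<in> carrier U1"
      by (simp add: U1_def)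
    then have "\<psi> a * cnj (\<psi> b) = op_mult d P (op_mult d P (local_tensor P (\<lambda>i. R i (cis t))) (projector \<psi>))
        (op_adjoint (local_tensor P (\<lambda>i. R i (cis t)))) a b"
      using inv that unfolding invariant_state_def Let_def op_eq_def projector_def by metis
    also have "\<dots> = \<phi> t a * cnj (\<phi> t b)"
      by (simp add: op_mult_def op_adjoint_def projector_def local_tensor_def \<phi>_def
          sum_distrib_left sum_distrib_right mult_ac)
    finally show ?thesis by simp
  qed
  have R0: "R i (cis 0) $$ (x, y) = (if x = y then 1 else 0)"
    if "i \<in> P" "x < d i" "y < d i" for i x y
    using circle_matrix_group.zero[OF grp[OF that(1)]] that by simp
  have \<phi>0: "\<phi> 0 a = \<psi> a" if a: "a \<in> ?M" for a
  proof -
    have "\<phi> 0 a = (\<Sum>c\<in>?M. (\<Prod>i\<in>P. if a i = c i then 1 else 0) * \<psi> c)"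
      unfolding \<phi>_def using a
      by (intro sum.cong prod.cong arg_cong2[of _ _ _ _ "(*)"] R0 refl)
        (auto dest: multi_index_less)
    also have "\<dots> = (\<Sum>c\<in>?M. if c = a then \<psi> c else 0)"
      using prod_delta_multi_index[OF P a] by (intro sum.cong refl) auto
    finally show ?thesis
      using a finite_multi_index[OF P] by simp
  qed
  have deriv: "((\<lambda>t. \<phi> t a) has_vector_derivative K a) (at 0)" if a: "a \<in> ?M" for a
  proof -
    have entry: "((\<lambda>t. R i (cis t) $$ (x, y)) has_vector_derivative H i $$ (x, y)) (at 0)"
      if "i \<in> P" "x < d i" "y < d i" for i x y
    proof -
      have "H i \<in> carrier_mat (d i) (d i)"
        and "((\<lambda>s. R i (cis s) $$ (x, y)) has_vector_derivative (R i (cis 0) * H i) $$ (x, y)) (at 0)"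
        using H[OF that(1)] that(2,3)
        unfolding circle_matrix_group.is_generator_def[OF grp[OF that(1)]] by blast+
      then show ?thesis
        by (simp add: circle_matrix_group.zero[OF grp[OF that(1)], simplified])
    qed
    have "((\<lambda>t. \<phi> t a) has_vector_derivative
        (\<Sum>c\<in>?M. (\<Sum>i\<in>P. H i $$ (a i, c i) * (\<Prod>j\<in>P - {i}. R j (cis 0) $$ (a j, c j))) * \<psi> c)) (at 0)"
      unfolding \<phi>_def
      by (intro has_vector_derivative_sum has_vector_derivative_mult_left
          has_vector_derivative_prod entry)
        (use a in \<open>auto dest: multi_index_less\<close>)
    also have "(\<Sum>c\<in>?M. (\<Sum>i\<in>P. H i $$ (a i, c i) * (\<Prod>j\<in>P - {i}. R j (cis 0) $$ (a j, c j))) * \<psi> c)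
      = (\<Sum>c\<in>?M. (\<Sum>i\<in>P. H i $$ (a i, c i) * (\<Prod>j\<in>P - {i}. if a j = c j then 1 else 0)) * \<psi> c)"
      using a by (intro sum.cong prod.cong arg_cong2[of _ _ _ _ "(*)"] R0 refl)
        (auto dest: multi_index_less)
    also have "\<dots> = (\<Sum>i\<in>P. \<Sum>c\<in>?M. (H i $$ (a i, c i) * \<psi> c) * (\<Prod>j\<in>P - {i}. if a j = c j then 1 else 0))"
      unfolding sum_distrib_right by (subst sum.swap) (simp add: mult_ac)
    also have "\<dots> = K a"
      unfolding K_def apply_local_def
      by (intro sum.cong refl) (simp add: sum_multi_index_one_site[OF P _ a])
    finally show ?thesis .
  qed
  have anti: "K a * cnj (\<psi> b) = - (\<psi> a * cnj (K b))" if a: "a \<in> ?M" and b: "b \<in> ?M" for a b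
  proof -
    have "((\<lambda>t. \<phi> t a * cnj (\<phi> t b)) has_vector_derivative
        \<phi> 0 a * cnj (K b) + K a * cnj (\<phi> 0 b)) (at 0)"
      by (intro has_vector_derivative_mult has_vector_derivative_cnj deriv a b)
    moreover have "((\<lambda>t. \<phi> t a * cnj (\<phi> t b)) has_vector_derivative 0) (at 0)"
      unfolding proj[OF a b] by simp
    ultimately have "\<phi> 0 a * cnj (K b) + K a * cnj (\<phi> 0 b) = 0"
      by (rule vector_derivative_unique_at)
    then show ?thesis
      by (simp add: \<phi>0 a b add_eq_0_iff)
  qed
  \<comment> \<open>This constant results from multiplying \<open>anti\<close> by
    \<open>\<psi> b\<close> and summing over \<open>b\<close>, since \<psi> has norm one.\<close>
  define c where "c = - (\<Sum>b\<in>?M. cnj (K b) * \<psi> b)"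
  have "K a = c * \<psi> a" if a: "a \<in> ?M" for a
  proof -
    have "K a = (\<Sum>b\<in>?M. K a * cnj (\<psi> b) * \<psi> b)"
      using pure_state_inner[OF pure] by (simp add: mult.assoc flip: sum_distrib_left)
    also have "\<dots> = (\<Sum>b\<in>?M. - (\<psi> a * cnj (K b)) * \<psi> b)"
      by (intro sum.cong refl) (simp add: anti[OF a])
    also have "\<dots> = c * \<psi> a"
      by (simp add: c_def sum_distrib_left sum_distrib_right sum_negf mult_ac)
    finally show ?thesis .
  qed
  then show ?thesis
    unfolding K_def by blast
qed

section \<open>Two-party correlations\<close>

text \<open>Entries of the two-party marginal indexed by plain numbers, row \<open>(x, y)\<close>
  and column \<open>(x', y')\<close>, so that sums over the two parties become ordinary double
  sums.\<close>

definition pair_marginal ::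
    "(nat \<Rightarrow> nat) \<Rightarrow> nat set \<Rightarrow> tensor_vec \<Rightarrow> nat \<Rightarrow> nat \<Rightarrow> nat \<Rightarrow> nat \<Rightarrow> nat \<Rightarrow> nat \<Rightarrow> complex" where
  "pair_marginal d P \<psi> k l x y x' y' = (\<Sum>c\<in>multi_index d (P - {k, l}).
     \<psi> (c(l := y, k := x)) * cnj (\<psi> (c(l := y', k := x'))))"

text \<open>Holds whenever \<open>\<rho>_{k,l} = \<one> \<otimes> r\<close> for some operator \<open>r\<close> on party \<open>l\<close>; this covers both
  \<open>\<rho>_{k,l} = \<one>/d k \<otimes> \<rho>_l\<close> and the maximally mixed case.\<close>

definition uncorrelated ::
    "(nat \<Rightarrow> nat) \<Rightarrow> nat set \<Rightarrow> tensor_vec \<Rightarrow> nat \<Rightarrow> nat \<Rightarrow> (nat \<Rightarrow> nat \<Rightarrow> complex) \<Rightarrow> bool" where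
  "uncorrelated d P \<psi> k l r \<longleftrightarrow> (\<forall>x<d k. \<forall>x'<d k. \<forall>y<d l. \<forall>y'<d l.
     pair_marginal d P \<psi> k l x y x' y' = (if x = x' then r y y' else 0))"

text \<open>The expectation of a product of local operators depends only on the pair marginal, and
  the trace of \<open>(Y \<otimes> Z) (1 \<otimes> r)\<close> is the trace of \<open>Y\<close> times
  the trace of \<open>Z r\<close>.\<close>

lemma uncorrelated_expectation:
  assumes k: "k \<in> P" and l: "l \<in> P" and kl: "l \<noteq> k" and r: "uncorrelated d P \<psi> k l r"
  shows "(\<Sum>a\<in>multi_index d P. cnj (\<psi> a) * apply_local d k Y (apply_local d l Z \<psi>) a) =
    (\<Sum>x<d k. Y $$ (x, x)) * (\<Sum>y'<d l. \<Sum>y<d l. Z $$ (y', y) * r y y')"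
proof -
  define Q where "Q = P - {k, l}"
  have Q: "P = insert k (insert l Q)" "k \<notin> insert l Q" "l \<notin> Q"
    using k l kl by (auto simp: Q_def)
  have upd: "c(k := x, l := y) = c(l := y, k := x)" for c :: "nat \<Rightarrow> nat" and x y
    using kl by auto
  have "(\<Sum>a\<in>multi_index d P. cnj (\<psi> a) * apply_local d k Y (apply_local d l Z \<psi>) a) =
      (\<Sum>x'<d k. \<Sum>y'<d l. \<Sum>c\<in>multi_index d Q. \<Sum>x<d k. \<Sum>y<d l.
        Y $$ (x', x) * Z $$ (y', y) * (\<psi> (c(l := y, k := x)) * cnj (\<psi> (c(l := y', k := x')))))"
    unfolding Q(1) sum_multi_index_insert[OF Q(2)] sum_multi_index_insert[OF Q(3)]
    using kl by (simp add: apply_local_def sum_distrib_left mult_ac upd)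
  also have "\<dots> = (\<Sum>x'<d k. \<Sum>y'<d l. \<Sum>x<d k. \<Sum>y<d l.
        Y $$ (x', x) * Z $$ (y', y) * pair_marginal d P \<psi> k l x y x' y')"
  proof (intro sum.cong refl)
    fix x' y'
    show "(\<Sum>c\<in>multi_index d Q. \<Sum>x<d k. \<Sum>y<d l.
        Y $$ (x', x) * Z $$ (y', y) * (\<psi> (c(l := y, k := x)) * cnj (\<psi> (c(l := y', k := x'))))) =
      (\<Sum>x<d k. \<Sum>y<d l. Y $$ (x', x) * Z $$ (y', y) * pair_marginal d P \<psi> k l x y x' y')"
      unfolding pair_marginal_def Q_def[symmetric] sum_distrib_left
      by (subst sum.swap, intro sum.cong refl, rule sum.swap)
  qed
  also have "\<dots> = (\<Sum>x'<d k. \<Sum>y'<d l. \<Sum>x<d k.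
        if x = x' then (\<Sum>y<d l. Y $$ (x', x) * (Z $$ (y', y) * r y y')) else 0)"
    using r unfolding uncorrelated_def by (intro sum.cong refl) (auto simp: mult.assoc)
  also have "\<dots> = (\<Sum>x<d k. Y $$ (x, x)) * (\<Sum>y'<d l. \<Sum>y<d l. Z $$ (y', y) * r y y')"
    by (simp add: sum_distrib_right flip: sum_distrib_left)
  finally show ?thesis .
qed

text \<open>The expectation of \<open>N\<close> times the sum of all \<open>H i\<close> is evaluated
  twice. By \<open>eig\<close> it is \<open>c\<close> times that of \<open>N\<close>, which is zero;
  term by term only \<open>i = k\<close> survives, giving a nonzero multiple of the trace of
  \<open>N * H k\<close>. The latter equals the trace of \<open>N * N\<close> because
  \<open>N\<close> is traceless.\<close>

lemma traces_vanish_if_uncorrelated: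
  assumes P: "finite P" and k: "k \<in> P" and l: "l \<in> P" "l \<noteq> k"
    and inner: "(\<Sum>a\<in>multi_index d P. cnj (\<psi> a) * \<psi> a) = 1"
    and H: "H k \<in> carrier_mat (d k) (d k)"
    and eig: "\<And>a. a \<in> multi_index d P \<Longrightarrow> (\<Sum>i\<in>P. apply_local d i (H i) \<psi> a) = c * \<psi> a"
    and r: "\<And>j. j \<in> P \<Longrightarrow> j \<noteq> k \<Longrightarrow> uncorrelated d P \<psi> k j (r j)"
  obtains \<mu> N where "N = H k - \<mu> \<cdot>\<^sub>m 1\<^sub>m (d k)" "(\<Sum>x<d k. N $$ (x, x)) = 0"
    "(\<Sum>x<d k. (N * N) $$ (x, x)) = 0"
proof
  let ?M = "multi_index d P" and ?E = "\<lambda>\<chi>. \<Sum>a\<in>multi_index d P. cnj (\<psi> a) * \<chi> a"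
  define \<mu> where "\<mu> = (\<Sum>x<d k. H k $$ (x, x)) / of_nat (d k)"
  define N where "N = H k - \<mu> \<cdot>\<^sub>m 1\<^sub>m (d k)"
  have N: "N \<in> carrier_mat (d k) (d k)"
    unfolding N_def by (rule minus_scalar_carrier)
  \<comment> \<open>The trace of \<open>r l\<close>. By \<open>E1\<close>, the one-party marginal at
    \<open>k\<close> acts in expectations as \<open>s\<close> times the identity.\<close>
  define s where "s = (\<Sum>y'<d l. \<Sum>y<d l. 1\<^sub>m (d l) $$ (y', y) * r l y y')"
  have E1: "?E (apply_local d k Y \<psi>) = (\<Sum>x<d k. Y $$ (x, x)) * s" for Y
  proof -
    \<comment> \<open>An identity is inserted at the auxiliary party \<open>l\<close>, so that a
      one-party expectation is read off from a pair marginal.\<close>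
    have "?E (apply_local d k Y \<psi>) = ?E (apply_local d k Y (apply_local d l (1\<^sub>m (d l)) \<psi>))"
      by (intro sum.cong arg_cong2[of _ _ _ _ "(*)"] refl apply_local_cong[OF _ k])
        (simp_all add: apply_local_one l)
    then show ?thesis
      using uncorrelated_expectation[OF k l r[OF l], of Y "1\<^sub>m (d l)"] by (simp add: s_def)
  qed
  have "?E (apply_local d k (1\<^sub>m (d k)) \<psi>) = 1"
    using inner by (simp add: apply_local_one k cong: sum.cong)
  \<comment> \<open>Normalisation supplies both \<open>s \<noteq> 0\<close> and
    \<open>d k \<noteq> 0\<close>; the latter makes the division in \<mu> meaningful.\<close>
  then have norm: "of_nat (d k) * s = 1"
    unfolding E1 by simp
  then have s: "s \<noteq> 0"
    by auto
  have dk: "d k \<noteq> 0"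
    using norm by (intro notI) simp
  show trN: "(\<Sum>x<d k. N $$ (x, x)) = 0"
    using H dk by (simp add: N_def \<mu>_def sum_subtractf)
  have E2: "?E (apply_local d k N (apply_local d j Z \<psi>)) = 0" if "j \<in> P" "j \<noteq> k" for j Z
    using uncorrelated_expectation[OF k that r[OF that], of N Z] trN by simp
  have "0 = c * ?E (apply_local d k N \<psi>)"
    by (simp add: E1 trN)
  also have "\<dots> = ?E (apply_local d k N (\<lambda>a. c * \<psi> a))"
    by (simp add: apply_local_scale sum_distrib_left mult.left_commute)
  also have "\<dots> = ?E (apply_local d k N (\<lambda>a. \<Sum>i\<in>P. apply_local d i (H i) \<psi> a))"
    by (intro sum.cong arg_cong2[of _ _ _ _ "(*)"] refl apply_local_cong[OF _ k]) (simp_all add: eig)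
  also have "\<dots> = (\<Sum>i\<in>P. ?E (apply_local d k N (apply_local d i (H i) \<psi>)))"
    by (simp add: apply_local_sum sum_distrib_left) (rule sum.swap)
  also have "\<dots> = ?E (apply_local d k N (apply_local d k (H k) \<psi>))"
    using E2 by (simp add: sum.remove[OF P k])
  also have "\<dots> = ?E (apply_local d k (N * H k) \<psi>)"
    by (intro sum.cong arg_cong2[of _ _ _ _ "(*)"] refl apply_local_mult[where P = P] N H k)
  also have "\<dots> = (\<Sum>x<d k. (N * H k) $$ (x, x)) * s"
    by (rule E1)
  finally have NH: "(\<Sum>x<d k. (N * H k) $$ (x, x)) = 0"
    using s by simp
  have "N * N = N * H k - N * (\<mu> \<cdot>\<^sub>m 1\<^sub>m (d k))"
    by (subst (2) N_def) (use N H in \<open>simp add: mult_minus_distrib_mat\<close>)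
  also have "N * (\<mu> \<cdot>\<^sub>m 1\<^sub>m (d k)) = \<mu> \<cdot>\<^sub>m N"
    using N by (simp add: mult_smult_distrib[of _ "d k" "d k" _ "d k"])
  finally have "(N * N) $$ (x, x) = (N * H k) $$ (x, x) - \<mu> * N $$ (x, x)" if "x < d k" for x
    using N H that by (simp del: index_mult_mat)
  then show "(\<Sum>x<d k. (N * N) $$ (x, x)) = 0"
    using NH trN by (simp add: sum_subtractf flip: sum_distrib_left)
qed (rule refl)

text \<open>Bridge to the general marginals: \<open>ix x y\<close> is the multi-index on
  \<open>{k, l}\<close> with value \<open>x\<close> at \<open>k\<close> and \<open>y\<close> at
  \<open>l\<close>.\<close>

lemma marginal_pair:
  assumes kl: "l \<noteq> k"
  defines "ix \<equiv> \<lambda>x y. \<lambda>i\<in>{k, l}. if i = k then x else y"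
  shows "marginal d P \<psi> {k, l} (ix x y) (ix x' y') = pair_marginal d P \<psi> k l x y x' y'"
proof -
  have "override_on c (ix x y) {k, l} = c(l := y, k := x)" for c x y
    using kl by (auto simp: ix_def override_on_def fun_eq_iff)
  then show ?thesis
    by (simp add: marginal_def partial_trace_def projector_def pair_marginal_def)
qed

text \<open>Both alternatives have the form of the identity on \<open>k\<close> tensored with some
  \<open>r\<close>: the marginal at \<open>l\<close> divided by \<open>d k\<close> in the first,
  \<open>c\<close> times the identity in the second.\<close>

lemma uncorrelated_if_marginal:
  assumes kl: "l \<noteq> k"
    and "op_eq d {k, l} (marginal d P \<psi> {k, l})
           (op_tensor {k} {l} (op_scale (1 / of_nat (d k)) op_id) (marginal d P \<psi> {l}))
      \<or> maximally_mixed d {k, l} (marginal d P \<psi> {k, l})"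
  shows "\<exists>r. uncorrelated d P \<psi> k l r"
proof -
  define ix where "ix x y = (\<lambda>i\<in>{k, l}. if i = k then x else y)" for x y :: nat
  have ix: "ix x y \<in> multi_index d {k, l}" if "x < d k" "y < d l" for x y
    using that by (auto simp: ix_def multi_index_def)
  note marg = marginal_pair[OF kl, of d P \<psi>, folded ix_def]
  from assms(2) show ?thesis
  proof
    assume "op_eq d {k, l} (marginal d P \<psi> {k, l})
      (op_tensor {k} {l} (op_scale (1 / of_nat (d k)) op_id) (marginal d P \<psi> {l}))"
    then have eq: "pair_marginal d P \<psi> k l x y x' y' =
        op_tensor {k} {l} (op_scale (1 / of_nat (d k)) op_id) (marginal d P \<psi> {l}) (ix x y) (ix x' y')"
      if "x < d k" "x' < d k" "y < d l" "y' < d l" for x x' y y'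
      using ix[OF that(1,3)] ix[OF that(2,4)] unfolding op_eq_def marg[symmetric] by blast
    have rk: "restrict (ix x y) {k} = restrict (ix x' y') {k} \<longleftrightarrow> x = x'" for x y x' y'
      by (auto simp: ix_def restrict_def fun_eq_iff)
    have rl: "restrict (ix x y) {l} = (\<lambda>i\<in>{l}. y)" for x y
      using kl by (auto simp: ix_def restrict_def fun_eq_iff)
    have "uncorrelated d P \<psi> k l
        (\<lambda>y y'. 1 / of_nat (d k) * marginal d P \<psi> {l} (\<lambda>i\<in>{l}. y) (\<lambda>i\<in>{l}. y'))"
      unfolding uncorrelated_def
      by (intro allI impI) (simp only: eq op_tensor_def op_scale_def op_id_def rk rl, simp)
    then show ?thesis by blast
  next
    assume "maximally_mixed d {k, l} (marginal d P \<psi> {k, l})"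
    then obtain c where "op_eq d {k, l} (marginal d P \<psi> {k, l}) (op_scale c op_id)"
      unfolding maximally_mixed_def by blast
    then have eq: "pair_marginal d P \<psi> k l x y x' y' = op_scale c op_id (ix x y) (ix x' y')"
      if "x < d k" "x' < d k" "y < d l" "y' < d l" for x x' y y'
      using ix[OF that(1,3)] ix[OF that(2,4)] unfolding op_eq_def marg[symmetric] by blast
    have ix_eq: "ix x y = ix x' y' \<longleftrightarrow> x = x' \<and> y = y'" for x y x' y'
      using kl by (auto simp: ix_def restrict_def fun_eq_iff)
    have "uncorrelated d P \<psi> k l (\<lambda>y y'. if y = y' then c else 0)"
      unfolding uncorrelated_def
      by (intro allI impI) (simp add: eq op_scale_def op_id_def ix_eq)
    then show ?thesis by blast
  qed
qed

section \<open>Contradiction at a party uncorrelated with all others\<close>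

theorem mainTheorem1:
  fixes n :: nat
    and d :: "nat \<Rightarrow> nat"
    and \<psi> :: tensor_vec
    and R :: "nat \<Rightarrow> complex \<Rightarrow> complex mat"
  assumes "n \<ge> 4"
    and "pure_state d {1..n} \<psi>"
    and "\<And>i. i \<in> {1..n} \<Longrightarrow> continuous_rep U1 (d i) (R i)"
    and "invariant_state U1 d {1..n} R \<psi>"
  shows "\<forall>k\<in>{1..n}. nontrivial_adjoint_action U1 (d k) (R k) \<longrightarrow>
    (\<exists>l\<in>{1..n}. l \<noteq> k \<and>
       \<not> op_eq d {k, l} (marginal d {1..n} \<psi> {k, l})
           (op_tensor {k} {l} (op_scale (1 / of_nat (d k)) op_id) (marginal d {1..n} \<psi> {l})) \<and>
       \<not> maximally_mixed d {k, l} (marginal d {1..n} \<psi> {k, l}))"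
proof (intro ballI impI, rule ccontr)
  let ?P = "{1..n}"
  fix k assume k: "k \<in> ?P" and nontriv: "nontrivial_adjoint_action U1 (d k) (R k)"
    and neg: "\<not> (\<exists>l\<in>?P. l \<noteq> k \<and>
       \<not> op_eq d {k, l} (marginal d ?P \<psi> {k, l})
           (op_tensor {k} {l} (op_scale (1 / of_nat (d k)) op_id) (marginal d ?P \<psi> {l})) \<and>
       \<not> maximally_mixed d {k, l} (marginal d ?P \<psi> {k, l}))"
  have grp: "circle_matrix_group (d i) (\<lambda>t. R i (cis t))" if "i \<in> ?P" for i
    by (rule continuous_rep_U1_circle_matrix_group[OF assms(3)[OF that]])
  have "\<forall>i\<in>?P. \<exists>H. circle_matrix_group.is_generator (d i) (\<lambda>t. R i (cis t)) H"
    using circle_matrix_group.ex_generator[OF grp] by blast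
  then obtain H where
    H: "\<And>i. i \<in> ?P \<Longrightarrow> circle_matrix_group.is_generator (d i) (\<lambda>t. R i (cis t)) (H i)"
    using bchoice by metis
  obtain c where eig: "\<And>a. a \<in> multi_index d ?P \<Longrightarrow>
      (\<Sum>i\<in>?P. apply_local d i (H i) \<psi> a) = c * \<psi> a"
    using invariant_state_generator[OF _ assms(2,4) grp H] by auto
  \<comment> \<open>The negated claim gives one of the two forms for each \<open>l\<close>, possibly
    a different one at different parties; \<open>uncorrelated\<close> treats them alike.\<close>
  have "\<forall>l\<in>?P - {k}. \<exists>r. uncorrelated d ?P \<psi> k l r"
    using neg uncorrelated_if_marginal by blast
  then obtain r where r: "\<And>l. l \<in> ?P \<Longrightarrow> l \<noteq> k \<Longrightarrow> uncorrelated d ?P \<psi> k l (r l)"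
    using bchoice by (metis Diff_iff singletonD)
  obtain l where l: "l \<in> ?P" "l \<noteq> k"
  proof (cases "k = 1")
    case True
    then show ?thesis using that[of 2] assms(1) by auto
  next
    case False
    then show ?thesis using that[of 1] assms(1) by auto
  qed
  have Hk: "H k \<in> carrier_mat (d k) (d k)"
    using H[OF k] circle_matrix_group.is_generator_def[OF grp[OF k]] by blast
  obtain \<mu> N where N: "N = H k - \<mu> \<cdot>\<^sub>m 1\<^sub>m (d k)" "(\<Sum>x<d k. N $$ (x, x)) = 0"
      "(\<Sum>x<d k. (N * N) $$ (x, x)) = 0"
    using traces_vanish_if_uncorrelated[OF _ k l pure_state_inner[OF assms(2)] Hk eig r] by blast
  have "\<exists>c. cmod c = 1 \<and> R k (cis t) = c \<cdot>\<^sub>m 1\<^sub>m (d k)" for t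
    by (rule circle_matrix_group.scalar_if_traces_vanish[OF grp[OF k] H[OF k] N])
  then show False
    using trivial_adjoint_action_if_scalar nontriv by blast
qed

end
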